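(* Let universal constants $C,C'>0$ be given, let $\bar\varepsilon>0$, and consider an instance $(x_0,(f,f';h))$ with $x_0\in\operatorname{dom}h$ such that $(f,f';h)$ satisfies the basic assumptions with a parameter triple $(M_f,M_h,\mu)$ such that $$\frac{CM_fd_0}{\bar\varepsilon}\ge1,\qquad M_h\le C'M_f,\qquad\mu=0.$$ Then the interval $\frac{\bar\varepsilon}{CM_f^2}\le\lambda\le\frac{Cd_0^2}{\bar\varepsilon}$ is nonempty, and for any $\lambda$ in it, RPB$(x_0,\lambda,\bar\varepsilon/2)$ has $\bar\varepsilon$-iteration complexity bound $\mathcal{O}_1(M_f^2d_0^2/\bar\varepsilon^2)$, i.e. the total number of (serious and null) iterations performed until some $\hat z_k$ with $\phi(\hat z_k)-\phi^*\le\bar\varepsilon$ is obtained is at most a constant, depending only on $C$ and $C'$, times $1+M_f^2d_0^2/\bar\varepsilon^2$.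
   Context: Problem: $\phi^*:=\min\{\phi(x):=f(x)+h(x):x\in\mathbb{R}^n\}$. We say $(f,f';h)$ satisfies the basic assumptions with parameters $(M_f,M_h,\mu)\in\mathbb{R}_+\times[0,\infty]\times\mathbb{R}_+$ if: (i) $f,h:\mathbb{R}^n\to(-\infty,+\infty]$ are proper lower semicontinuous convex, $\operatorname{dom}h\subset\operatorname{dom}f$, and $f':\operatorname{dom}h\to\mathbb{R}^n$ satisfies $f'(x)\in\partial f(x)$ for all $x\in\operatorname{dom}h$; (ii) the set $X^*$ of minimizers of $\phi$ is nonempty; (iii) $h$ is $\mu$-convex, i.e. $h(\alpha z+(1-\alpha)u)\le\alpha h(z)+(1-\alpha)h(u)-\frac{\alpha(1-\alpha)\mu}{2}\|z-u\|^2$ for all $z,u\in\operatorname{dom}h$, $\alpha\in[0,1]$, and $\|f'(x)\|\le M_f$ for all $x\in\operatorname{dom}h$; (iv) $|h(u)-h(v)|\le M_h\|u-v\|$ for all $u,v\in\operatorname{dom}h$. Here $\|\cdot\|$ is the Euclidean norm. $d_0:=\inf\{\|x_0-x^*\|:x^*\in X^*\}$. Method RPB$(x_0,\lambda,\delta)$ ($x_0\in\operatorname{dom}h$, $\lambda>0$, $\delta>0$). Set $x_0^c=\tilde x_0=\hat z_0=x_0$, $C_1=\{x_0\}$, $k=1$. For $j=1,2,\dots$: let $f_j(u)=\max\{f(x)+\langle f'(x),u-x\rangle:x\in C_j\}$; let $x_j$ be the unique minimizer and $m_j$ the minimum value over $u\in\mathbb{R}^n$ of $f_j(u)+h(u)+\frac1{2\lambda}\|u-x_{j-1}^c\|^2$;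 let $\phi_j^\lambda:=\phi+\frac1{2\lambda}\|\cdot-x_{j-1}^c\|^2$; choose $\tilde x_j\in\operatorname{Argmin}\{\phi_j^\lambda(u):u\in\{x_j,\tilde x_{j-1}\}\}$; let $t_j:=\phi_j^\lambda(\tilde x_j)-m_j$. If $t_j\le\delta$ (iteration $j$ is serious): choose any finite $C_{j+1}$ with $\{x_j\}\subset C_{j+1}\subset\{x_0,\dots,x_j\}$, set $x_j^c=x_j$, choose $\hat z_k\in\operatorname{Argmin}\{\phi(u):u\in\{\hat z_{k-1},\tilde x_j\}\}$, and increase $k$ by 1. Otherwise (iteration $j$ is null): set $x_j^c=x_{j-1}^c$ and choose any $C_{j+1}$ with $A_j\cup\{x_j\}\subset C_{j+1}\subset C_j\cup\{x_j\}$, where $A_j:=\{x\in C_j:f(x)+\langle f'(x),x_j-x\rangle=f_j(x_j)\}$. The statement holds for all admissible choices. $p=\mathcal{O}_1(q)$ means $p\le\bar c\,(q+1)$ for a constant $\bar c$. *)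

theory Defs
  imports "HOL-Analysis.Analysis"
begin

section \<open>The spaces \<open>\<real>\<^sup>n\<close>, for all \<open>n\<close> at once\<close>

text \<open>
  The constant of the complexity bound must not depend on the dimension, so \<open>n\<close> has to be
  quantified inside the formula, after that constant. A type-indexed space such as
  \<^typ>\<open>real ^ 'n\<close> does not allow this. Hence \<open>\<real>\<^sup>n\<close> is realised as the space of the real
  sequences vanishing from index \<open>n\<close> on, with the Euclidean inner product. All of these spaces
  are subspaces of one type, that of the eventually vanishing real sequences.
\<close>

typedef vec0 = "{x :: nat \<Rightarrow> real. finite {i. x i \<noteq> 0}}"
  morphisms coord Vec0
  by (rule exI[of _ "\<lambda>_. 0"]) simp

setup_lifting type_definition_vec0

lemma finite_coord: "finite {i. coord x i \<noteq> 0}"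
  using coord[of x] by simp

lemma vec0_eqI: "(\<And>i. coord x i = coord y i) \<Longrightarrow> x = y"
  by (metis coord_inject ext)

instantiation vec0 :: real_vector
begin

lift_definition zero_vec0 :: vec0 is "\<lambda>_. 0" by simp

lift_definition plus_vec0 :: "vec0 \<Rightarrow> vec0 \<Rightarrow> vec0" is "\<lambda>x y i. x i + y i"
proof -
  fix x y :: "nat \<Rightarrow> real"
  assume "finite {i. x i \<noteq> 0}" "finite {i. y i \<noteq> 0}"
  then show "finite {i. x i + y i \<noteq> 0}"
    by (rule finite_subset[rotated, OF finite_UnI]) auto
qed

lift_definition minus_vec0 :: "vec0 \<Rightarrow> vec0 \<Rightarrow> vec0" is "\<lambda>x y i. x i - y i"
proof -
  fix x y :: "nat \<Rightarrow> real"
  assume "finite {i. x i \<noteq> 0}" "finite {i. y i \<noteq> 0}"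
  then show "finite {i. x i - y i \<noteq> 0}"
    by (rule finite_subset[rotated, OF finite_UnI]) auto
qed

lift_definition uminus_vec0 :: "vec0 \<Rightarrow> vec0" is "\<lambda>x i. - x i" by simp

lift_definition scaleR_vec0 :: "real \<Rightarrow> vec0 \<Rightarrow> vec0" is "\<lambda>r x i. r * x i"
  by (rule finite_subset[rotated]) auto

instance
  by standard (transfer; simp add: algebra_simps)+

end

lemma coord_zero [simp]: "coord 0 i = 0"
  by transfer simp

lemma coord_add [simp]: "coord (x + y) i = coord x i + coord y i"
  by transfer simp

lemma coord_diff [simp]: "coord (x - y) i = coord x i - coord y i"
  by transfer simp

lemma coord_minus [simp]: "coord (- x) i = - coord x i"
  by transfer simp

lemma coord_scaleR [simp]: "coord (r *\<^sub>R x) i = r * coord x i"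
  by transfer simp

instantiation vec0 :: real_inner
begin

definition inner_vec0 :: "vec0 \<Rightarrow> vec0 \<Rightarrow> real" where
  "inner_vec0 x y = (\<Sum>i | coord x i \<noteq> 0. coord x i * coord y i)"

definition norm_vec0 :: "vec0 \<Rightarrow> real" where
  "norm_vec0 x = sqrt (inner x x)"

definition sgn_vec0 :: "vec0 \<Rightarrow> vec0" where
  "sgn_vec0 x = x /\<^sub>R norm x"

definition dist_vec0 :: "vec0 \<Rightarrow> vec0 \<Rightarrow> real" where
  "dist_vec0 x y = norm (x - y)"

definition uniformity_vec0 :: "(vec0 \<times> vec0) filter" where
  "uniformity_vec0 = (INF e\<in>{0<..}. principal {(x, y). dist x y < e})"

definition open_vec0 :: "vec0 set \<Rightarrow> bool" where
  "open_vec0 U \<longleftrightarrow> (\<forall>x\<in>U. eventually (\<lambda>(x', y). x' = x \<longrightarrow> y \<in> U) uniformity)"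

lemma inner_vec0_superset:
  assumes "finite A" "{i. coord x i \<noteq> 0} \<subseteq> A"
  shows "inner x y = (\<Sum>i\<in>A. coord x i * coord y i)"
  unfolding inner_vec0_def by (rule sum.mono_neutral_left) (use assms in auto)

instance
proof
  fix x y z :: vec0 and r :: real and U :: "vec0 set"
  let ?A = "{i. coord x i \<noteq> 0} \<union> {i. coord y i \<noteq> 0} \<union> {i. coord z i \<noteq> 0}"
  have A: "finite ?A"
    by (simp add: finite_coord)
  note sup = inner_vec0_superset[OF A]
  have xy: "inner x y = (\<Sum>i\<in>?A. coord x i * coord y i)"
    and yx: "inner y x = (\<Sum>i\<in>?A. coord y i * coord x i)"
    and xz: "inner x z = (\<Sum>i\<in>?A. coord x i * coord z i)"
    and yz: "inner y z = (\<Sum>i\<in>?A. coord y i * coord z i)"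
    and xyz: "inner (x + y) z = (\<Sum>i\<in>?A. coord (x + y) i * coord z i)"
    and rxy: "inner (r *\<^sub>R x) y = (\<Sum>i\<in>?A. coord (r *\<^sub>R x) i * coord y i)"
    by (rule sup; auto)+
  show "dist x y = norm (x - y)" by (rule dist_vec0_def)
  show "sgn x = x /\<^sub>R norm x" by (rule sgn_vec0_def)
  show "uniformity = (INF e\<in>{0<..}. principal {(x :: vec0, y). dist x y < e})"
    by (rule uniformity_vec0_def)
  show "open U \<longleftrightarrow> (\<forall>x\<in>U. eventually (\<lambda>(x', y). x' = x \<longrightarrow> y \<in> U) uniformity)"
    by (rule open_vec0_def)
  show "inner x y = inner y x"
    unfolding xy yx by (simp add: mult.commute)
  show "inner (x + y) z = inner x z + inner y z"
    unfolding xyz xz yz by (simp add: sum.distrib distrib_right)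
  show "inner (r *\<^sub>R x) y = r * inner x y"
    unfolding rxy xy by (simp add: sum_distrib_left mult.assoc)
  show "0 \<le> inner x x"
    unfolding inner_vec0_def by (simp add: sum_nonneg)
  show "inner x x = 0 \<longleftrightarrow> x = 0"
  proof
    assume "inner x x = 0"
    then have "\<forall>i\<in>{i. coord x i \<noteq> 0}. coord x i * coord x i = 0"
      unfolding inner_vec0_def
      by (subst (asm) sum_nonneg_eq_0_iff) (auto simp: finite_coord)
    then show "x = 0"
      by (intro vec0_eqI) auto
  qed (simp add: inner_vec0_def)
  show "norm x = sqrt (inner x x)" by (rule norm_vec0_def)
qed

end

definition Rn :: "nat \<Rightarrow> vec0 set" where
  "Rn n = {x. \<forall>i\<ge>n. coord x i = 0}"

lemma inner_Rn:
  assumes "x \<in> Rn n"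
  shows "inner x y = (\<Sum>i<n. coord x i * coord y i)"
  by (rule inner_vec0_superset) (use assms in \<open>auto simp: Rn_def not_le[symmetric]\<close>)

lemma subspace_Rn: "subspace (Rn n)"
  by (auto simp: Rn_def subspace_def)


section \<open>Extended-real-valued convex functions on a subspace \<open>E\<close>\<close>

text \<open>Functions are total on the type, but only their values on \<open>E\<close> are ever used.\<close>

definition edom :: "'a set \<Rightarrow> ('a \<Rightarrow> ereal) \<Rightarrow> 'a set" where
  "edom E f = {x \<in> E. f x < \<infinity>}"

definition proper_on :: "'a set \<Rightarrow> ('a \<Rightarrow> ereal) \<Rightarrow> bool" where
  "proper_on E f \<longleftrightarrow> (\<forall>x\<in>E. f x \<noteq> -\<infinity>) \<and> edom E f \<noteq> {}"

definition lsc_on :: "'a::topological_space set \<Rightarrow> ('a \<Rightarrow> ereal) \<Rightarrow> bool" where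
  "lsc_on E f \<longleftrightarrow> (\<forall>x\<in>E. f x \<le> Liminf (at x within E) f)"

definition econvex_on :: "'a::real_vector set \<Rightarrow> ('a \<Rightarrow> ereal) \<Rightarrow> bool" where
  "econvex_on E f \<longleftrightarrow> (\<forall>z\<in>E. \<forall>u\<in>E. \<forall>a\<in>{0..1::real}.
     f (a *\<^sub>R z + (1 - a) *\<^sub>R u) \<le> ereal a * f z + ereal (1 - a) * f u)"

definition strongly_convex_on :: "real \<Rightarrow> 'a::real_normed_vector set \<Rightarrow> ('a \<Rightarrow> ereal) \<Rightarrow> bool" where
  "strongly_convex_on mu E h \<longleftrightarrow> (\<forall>z\<in>edom E h. \<forall>u\<in>edom E h. \<forall>a\<in>{0..1::real}.
     h (a *\<^sub>R z + (1 - a) *\<^sub>R u)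
       \<le> ereal a * h z + ereal (1 - a) * h u - ereal (a * (1 - a) * mu / 2 * (norm (z - u))\<^sup>2))"

definition subdifferential :: "'a::real_inner set \<Rightarrow> ('a \<Rightarrow> ereal) \<Rightarrow> 'a \<Rightarrow> 'a set" where
  "subdifferential E f x = {s \<in> E. \<forall>y\<in>E. f x + ereal (inner s (y - x)) \<le> f y}"

definition Argmin :: "'a set \<Rightarrow> ('a \<Rightarrow> ereal) \<Rightarrow> 'a set" where
  "Argmin S g = {x \<in> S. \<forall>y\<in>S. g x \<le> g y}"


section \<open>The composite problem\<close>

definition objective :: "('a \<Rightarrow> ereal) \<Rightarrow> ('a \<Rightarrow> ereal) \<Rightarrow> 'a \<Rightarrow> ereal" where
  "objective f h x = f x + h x"

definition opt_value :: "'a set \<Rightarrow> ('a \<Rightarrow> ereal) \<Rightarrow> ('a \<Rightarrow> ereal) \<Rightarrow> ereal" where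
  "opt_value E f h = (INF x\<in>E. objective f h x)"

definition opt_set :: "'a set \<Rightarrow> ('a \<Rightarrow> ereal) \<Rightarrow> ('a \<Rightarrow> ereal) \<Rightarrow> 'a set" where
  "opt_set E f h = Argmin E (objective f h)"

definition opt_dist ::
  "'a::real_normed_vector set \<Rightarrow> ('a \<Rightarrow> ereal) \<Rightarrow> ('a \<Rightarrow> ereal) \<Rightarrow> 'a \<Rightarrow> real" where
  "opt_dist E f h x0 = (INF xs\<in>opt_set E f h. norm (x0 - xs))"

locale basic_assumptions =
  fixes E :: "'a::real_inner set" and f :: "'a \<Rightarrow> ereal" and f' :: "'a \<Rightarrow> 'a" and h :: "'a \<Rightarrow> ereal"
    and Mf :: real and Mh :: ereal and mu :: real
  assumes parameters: "0 \<le> Mf" "0 \<le> Mh" "0 \<le> mu"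
    and f: "proper_on E f" "lsc_on E f" "econvex_on E f"
    and h: "proper_on E h" "lsc_on E h" "econvex_on E h"
    and dom_subset: "edom E h \<subseteq> edom E f"
    and subgradient: "x \<in> edom E h \<Longrightarrow> f' x \<in> subdifferential E f x"
    and opt_set_nonempty: "opt_set E f h \<noteq> {}"
    and h_strongly_convex: "strongly_convex_on mu E h"
    and subgradient_bound: "x \<in> edom E h \<Longrightarrow> norm (f' x) \<le> Mf"
    and h_lipschitz: "u \<in> edom E h \<Longrightarrow> v \<in> edom E h \<Longrightarrow> \<bar>h u - h v\<bar> \<le> Mh * ereal (norm (u - v))"


section \<open>The relaxed proximal bundle method\<close>

definition linearization ::
  "('a::real_inner \<Rightarrow> ereal) \<Rightarrow> ('a \<Rightarrow> 'a) \<Rightarrow> 'a \<Rightarrow> 'a \<Rightarrow> ereal" where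
  "linearization f f' x u = f x + ereal (inner (f' x) (u - x))"

definition cut_model ::
  "('a::real_inner \<Rightarrow> ereal) \<Rightarrow> ('a \<Rightarrow> 'a) \<Rightarrow> 'a set \<Rightarrow> 'a \<Rightarrow> ereal" where
  "cut_model f f' B u = Max ((\<lambda>x. linearization f f' x u) ` B)"

definition prox_term :: "real \<Rightarrow> 'a::real_normed_vector \<Rightarrow> 'a \<Rightarrow> ereal" where
  "prox_term lam c u = ereal (1 / (2 * lam) * (norm (u - c))\<^sup>2)"

definition model_objective ::
  "('a::real_inner \<Rightarrow> ereal) \<Rightarrow> ('a \<Rightarrow> 'a) \<Rightarrow> ('a \<Rightarrow> ereal) \<Rightarrow> real \<Rightarrow> 'a set \<Rightarrow> 'a \<Rightarrow> 'a \<Rightarrow> ereal" where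
  "model_objective f f' h lam B c u = cut_model f f' B u + h u + prox_term lam c u"

definition prox_objective ::
  "('a::real_normed_vector \<Rightarrow> ereal) \<Rightarrow> ('a \<Rightarrow> ereal) \<Rightarrow> real \<Rightarrow> 'a \<Rightarrow> 'a \<Rightarrow> ereal" where
  "prox_objective f h lam c u = objective f h u + prox_term lam c u"

definition active_set ::
  "('a::real_inner \<Rightarrow> ereal) \<Rightarrow> ('a \<Rightarrow> 'a) \<Rightarrow> 'a set \<Rightarrow> 'a \<Rightarrow> 'a set" where
  "active_set f f' B u = {x \<in> B. linearization f f' x u = cut_model f f' B u}"

text \<open>
  A run of the method consists of the iterates \<open>x j\<close>, the prox-centers \<open>xc j\<close>, the points
  \<open>xt j\<close> (written \<open>x\<close>-tilde), the points \<open>zh k\<close> (written \<open>z\<close>-hat), the bundles \<open>B j\<close>, and the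
  value \<open>k j\<close> of the cycle counter at the start of iteration \<open>j\<close>. Thus exactly
  \<open>zh 0, \<dots>, zh (k (j + 1) - 1)\<close> are available after \<open>j\<close> iterations. The values \<open>B 0\<close> and \<open>k 0\<close>
  play no role. A run is any outcome of the choices that the method leaves open.
\<close>

locale rpb_run =
  fixes E :: "'a::real_inner set" and f :: "'a \<Rightarrow> ereal" and f' :: "'a \<Rightarrow> 'a" and h :: "'a \<Rightarrow> ereal"
    and x0 :: 'a and lam :: real and delta :: real
    and x xc xt zh :: "nat \<Rightarrow> 'a" and B :: "nat \<Rightarrow> 'a set" and k :: "nat \<Rightarrow> nat"
    and m t :: "nat \<Rightarrow> ereal"
  assumes input: "x0 \<in> edom E h" "0 < lam" "0 < delta"
    and init: "x 0 = x0" "xc 0 = x0" "xt 0 = x0" "zh 0 = x0" "B 1 = {x0}" "k 1 = 1"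
    and iterate: "1 \<le> j \<Longrightarrow> Argmin E (model_objective f f' h lam (B j) (xc (j - 1))) = {x j}"
    and model_value: "1 \<le> j \<Longrightarrow> m j = (INF u\<in>E. model_objective f f' h lam (B j) (xc (j - 1)) u)"
    and tilde: "1 \<le> j \<Longrightarrow> xt j \<in> Argmin {x j, xt (j - 1)} (prox_objective f h lam (xc (j - 1)))"
    and gap: "1 \<le> j \<Longrightarrow> t j = prox_objective f h lam (xc (j - 1)) (xt j) - m j"
    and serious: "1 \<le> j \<Longrightarrow> t j \<le> ereal delta \<Longrightarrow>
      finite (B (j + 1)) \<and> {x j} \<subseteq> B (j + 1) \<and> B (j + 1) \<subseteq> x ` {0..j} \<and>
      xc j = x j \<and>
      zh (k j) \<in> Argmin {zh (k j - 1), xt j} (objective f h) \<and>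
      k (j + 1) = k j + 1"
    and null: "1 \<le> j \<Longrightarrow> \<not> t j \<le> ereal delta \<Longrightarrow>
      xc j = xc (j - 1) \<and>
      active_set f f' (B j) (x j) \<union> {x j} \<subseteq> B (j + 1) \<and> B (j + 1) \<subseteq> B j \<union> {x j} \<and>
      k (j + 1) = k j"

definition rpb_iteration_bound ::
  "'a::real_inner set \<Rightarrow> ('a \<Rightarrow> ereal) \<Rightarrow> ('a \<Rightarrow> 'a) \<Rightarrow> ('a \<Rightarrow> ereal) \<Rightarrow> 'a \<Rightarrow> real \<Rightarrow> real
     \<Rightarrow> real \<Rightarrow> real \<Rightarrow> bool" where
  "rpb_iteration_bound E f f' h x0 lam delta eps N \<longleftrightarrow>
     (\<forall>x xc xt zh B k m t. rpb_run E f f' h x0 lam delta x xc xt zh B k m t \<longrightarrow>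
        (\<exists>j i. real j \<le> N \<and> i < k (j + 1) \<and>
           objective f h (zh i) - opt_value E f h \<le> ereal eps))"

end

theory Submission
  imports Defs
begin

text \<open>
  Only the gaps \<open>t j\<close> and the distances from the prox-centers to a minimizer have to be followed.

  Since \<open>h\<close> is convex, the model plus the proximal term is \<open>1 / \<lambda>\<close>-strongly convex, so it grows
  quadratically around its minimizer \<open>x j\<close>. This growth survives when only the cuts active at
  \<open>x j\<close> are kept (\<open>model_growth\<close>), which is exactly what a null iteration guarantees for the next
  bundle. Hence after a null iteration the model value rises by at least
  \<open>\<parallel>x (j + 1) - x j\<parallel>\<^sup>2 / (2 \<lambda>)\<close>. On the other hand the new bundle contains the cut at \<open>x j\<close>, whose error at
  \<open>x (j + 1)\<close> is at most \<open>2 M\<^sub>f \<parallel>x (j + 1) - x j\<parallel>\<close>. Eliminating the norm gives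
  \<open>t (j + 1) + a t (j + 1)\<^sup>2 \<le> t j\<close> with \<open>a = 1 / (8 \<lambda> M\<^sub>f\<^sup>2)\<close> (\<open>gap_recursion\<close>). The Lipschitz
  continuity of \<open>h\<close> bounds the gap at the start of a cycle by a constant times \<open>1 / a\<close>
  (\<open>gap_bound_cycle_start\<close>). A sequence with these two properties is \<open>O(1 / (a i))\<close> after \<open>i\<close> steps
  (\<open>harmonic_decay\<close>), without any logarithm, so that at most \<open>O(\<lambda> M\<^sub>f\<^sup>2 / \<delta>)\<close> null iterations can
  follow each other (\<open>null_run_length\<close>).

  For a serious iteration, the growth of the model tested at a minimizer \<open>x\<^sup>*\<close> yields
  \<open>\<phi>(xt j) - \<phi>\<^sup>* \<le> \<delta> + (\<parallel>x\<^sup>* - xc (j - 1)\<parallel>\<^sup>2 - \<parallel>x\<^sup>* - xc j\<parallel>\<^sup>2) / (2 \<lambda>)\<close> (\<open>serious_estimate\<close>). With \<open>\<delta> = \<epsilon> / 2\<close>,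
  as long as no \<open>\<epsilon>\<close>-solution is found each serious iteration decreases the squared distance to \<open>x\<^sup>*\<close>
  by \<open>\<lambda> \<epsilon>\<close>, which can happen at most \<open>d\<^sub>0\<^sup>2 / (\<lambda> \<epsilon>)\<close> times.

  The product \<open>(d\<^sub>0\<^sup>2 / (\<lambda> \<epsilon>) + 1) (O(\<lambda> M\<^sub>f\<^sup>2 / \<epsilon>) + 1)\<close> bounds the number of iterations. The two ends of the
  interval of prox stepsizes say precisely that neither summand \<open>1\<close> dominates its factor, and the
  stepsize cancels from what remains (\<open>stepsize_window_count_bound\<close>).
\<close>

section \<open>Quadratic growth and finite maxima of affine functions\<close>

lemma norm_segment_square:
  fixes y u c :: "'a::real_inner"
  shows "(norm (y + s *\<^sub>R (u - y) - c))\<^sup>2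
    = (1 - s) * (norm (y - c))\<^sup>2 + s * (norm (u - c))\<^sup>2 - s * (1 - s) * (norm (u - y))\<^sup>2"
proof -
  define p q where "p = y - c" and "q = u - c"
  have "y + s *\<^sub>R (u - y) - c = (1 - s) *\<^sub>R p + s *\<^sub>R q" and "y - c = p" "u - c = q" "u - y = q - p"
    by (simp_all add: p_def q_def algebra_simps)
  then show ?thesis
    by (simp add: power2_norm_eq_inner inner_commute algebra_simps)
qed

text \<open>
  A minimizer along the initial parts of all segments suffices: comparing with the point at
  parameter \<open>s\<close>, dividing by \<open>s\<close> and letting \<open>s\<close> tend to \<open>0\<close> recovers the full curvature of the
  quadratic term. The local form is what permits replacing a model by another one that agrees
  with it only near the minimizer.
\<close>

lemma quadratic_growth:
  fixes G :: "'a::real_inner \<Rightarrow> real"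
  assumes G: "convex_on D G" and y: "y \<in> D" and u: "u \<in> D"
    and min: "\<forall>\<^sub>F s in at_right 0. G y + w * (norm (y - c))\<^sup>2
      \<le> G (y + s *\<^sub>R (u - y)) + w * (norm (y + s *\<^sub>R (u - y) - c))\<^sup>2"
  shows "G y + w * (norm (y - c))\<^sup>2 + w * (norm (u - y))\<^sup>2 \<le> G u + w * (norm (u - c))\<^sup>2"
proof -
  let ?l = "\<lambda>s. G y + w * (norm (y - c))\<^sup>2 + (1 - s) * (w * (norm (u - y))\<^sup>2)"
  let ?r = "G u + w * (norm (u - c))\<^sup>2"
  have "\<forall>\<^sub>F s in at_right 0. ?l s \<le> ?r"
    using min eventually_at_right_real[OF zero_less_one]
  proof eventually_elim
    case (elim s)
    have "G (y + s *\<^sub>R (u - y)) = G ((1 - s) *\<^sub>R y + s *\<^sub>R u)"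
      by (simp add: algebra_simps)
    also have "\<dots> \<le> (1 - s) * G y + s * G u"
      using convex_onD[OF G, of s y u] elim y u by auto
    finally have "s * ?l s \<le> s * ?r"
      using elim(1)[unfolded norm_segment_square] by (simp add: algebra_simps)
    then show ?case
      using elim(2) by simp
  qed
  moreover have "(?l \<longlongrightarrow> G y + w * (norm (y - c))\<^sup>2 + (1 - 0) * (w * (norm (u - y))\<^sup>2)) (at_right 0)"
    by (intro tendsto_intros)
  ultimately show ?thesis
    using tendsto_upperbound[of ?l _ "at_right 0" ?r] by simp
qed

lemma convex_on_Max_affine:
  fixes b :: "'b \<Rightarrow> real" and g p :: "'b \<Rightarrow> 'a::real_inner"
  assumes "convex D" "finite B" "B \<noteq> {}"
  shows "convex_on D (\<lambda>u. Max ((\<lambda>i. b i + inner (g i) (u - p i)) ` B))"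
proof (rule convex_onI)
  fix s :: real and y u
  assume s: "0 < s" "s < 1"
  let ?a = "\<lambda>u i. b i + inner (g i) (u - p i)"
  show "Max (?a ((1 - s) *\<^sub>R y + s *\<^sub>R u) ` B) \<le> (1 - s) * Max (?a y ` B) + s * Max (?a u ` B)"
  proof (subst Max_le_iff; (intro ballI)?)
    fix r assume "r \<in> ?a ((1 - s) *\<^sub>R y + s *\<^sub>R u) ` B"
    then obtain i where i: "i \<in> B" "r = ?a ((1 - s) *\<^sub>R y + s *\<^sub>R u) i"
      by auto
    have "r = (1 - s) * ?a y i + s * ?a u i"
      unfolding i(2) by (simp add: inner_simps algebra_simps)
    also have "\<dots> \<le> (1 - s) * Max (?a y ` B) + s * Max (?a u ` B)"
      using i(1) s assms by (intro add_mono mult_left_mono Max_ge) auto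
    finally show "r \<le> (1 - s) * Max (?a y ` B) + s * Max (?a u ` B)" .
  qed (use assms in auto)
qed (use assms in auto)

text \<open>
  At \<open>y\<close> the inactive pieces lie strictly below the maximum and there are finitely many of them, so
  by continuity they stay below an active piece near \<open>y\<close>.
\<close>

lemma Max_affine_active_eventually_eq:
  fixes b :: "'b \<Rightarrow> real" and g p :: "'b \<Rightarrow> 'a::real_inner"
  defines "a \<equiv> \<lambda>u i. b i + inner (g i) (u - p i)"
  assumes B: "finite B" "B \<noteq> {}"
    and A: "A = {i \<in> B. a y i = Max (a y ` B)}"
  shows "\<forall>\<^sub>F s in at_right 0. Max (a (y + s *\<^sub>R v) ` A) = Max (a (y + s *\<^sub>R v) ` B)"
proof -
  have "Max (a y ` B) \<in> a y ` B"
    using B by (intro Max_in) auto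
  then obtain i0 where i0: "i0 \<in> A"
    unfolding A by auto
  have "\<forall>\<^sub>F s in at_right 0. a (y + s *\<^sub>R v) i \<le> a (y + s *\<^sub>R v) i0" if i: "i \<in> B - A" for i
  proof -
    have lt: "a y i < a y i0"
      using i i0 B by (auto simp: A less_le)
    have *: "((\<lambda>s. a (y + s *\<^sub>R v) i) \<longlongrightarrow> a (y + 0 *\<^sub>R v) i) (at_right 0)" for i
      unfolding a_def by (intro tendsto_intros)
    have "\<forall>\<^sub>F s in at_right 0. 0 < a (y + s *\<^sub>R v) i0 - a (y + s *\<^sub>R v) i"
      using lt by (intro order_tendstoD(1)[OF tendsto_diff[OF * *]]) simp
    then show ?thesis
      by eventually_elim simp
  qed
  then have "\<forall>\<^sub>F s in at_right 0. \<forall>i\<in>B - A. a (y + s *\<^sub>R v) i \<le> a (y + s *\<^sub>R v) i0"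
    using B by (intro eventually_ball_finite) auto
  then show ?thesis
  proof eventually_elim
    case (elim s)
    have AB: "A \<subseteq> B" "finite A"
      using B A finite_subset by auto
    have "a (y + s *\<^sub>R v) i \<le> Max (a (y + s *\<^sub>R v) ` A)" if "i \<in> B" for i
    proof (cases "i \<in> A")
      case True
      then show ?thesis using AB by simp
    next
      case False
      then have "a (y + s *\<^sub>R v) i \<le> a (y + s *\<^sub>R v) i0"
        using elim that by blast
      also have "\<dots> \<le> Max (a (y + s *\<^sub>R v) ` A)"
        using AB i0 by simp
      finally show ?thesis .
    qed
    then show ?case
      using AB B i0 by (intro antisym Max_mono image_mono Max.boundedI) auto
  qed
qed

section \<open>A sequence whose decrease is quadratic in its next value\<close>

text \<open>
  The model case is \<open>T' = - a T\<^sup>2\<close>, whose solutions are at most \<open>1 / (a i)\<close> whatever their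
  initial value. In discrete time the rate \<open>c / (a (i + 1))\<close> reproduces itself: a next value
  above \<open>c / (a (i + 2))\<close> would force the present one above \<open>c / (a (i + 1))\<close> as soon as \<open>c \<ge> 2\<close>.
\<close>

lemma harmonic_decay:
  fixes T :: "nat \<Rightarrow> real"
  assumes "0 < a" "2 \<le> c" and T0: "a * T 0 \<le> c"
    and step: "\<And>i. i < n \<Longrightarrow> 0 \<le> T (Suc i) \<Longrightarrow> T (Suc i) + a * (T (Suc i))\<^sup>2 \<le> T i"
  shows "a * T n * (real n + 1) \<le> c"
  using step
proof (induction n)
  case 0
  then show ?case using T0 by simp
next
  case (Suc n)
  then have IH: "a * T n * (real n + 1) \<le> c" by simp
  show ?case
  proof (rule ccontr)
    assume "\<not> ?case"
    define p where "p = a * T (Suc n)"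
    define r where "r = real n + 1"
    have r: "1 \<le> r" by (simp add: r_def)
    have big: "c < p * (r + 1)"
      using \<open>\<not> ?case\<close> by (simp add: p_def r_def add_ac)
    have p: "0 < p"
      using big r assms(2) by (smt (verit) mult_nonpos_nonneg)
    then have "0 \<le> T (Suc n)"
      using assms(1) by (simp add: p_def zero_less_mult_iff)
    then have "a * (T (Suc n) + a * (T (Suc n))\<^sup>2) \<le> a * T n"
      using Suc.prems[of n] assms(1) by (intro mult_left_mono) auto
    then have "p + p\<^sup>2 \<le> a * T n"
      by (simp add: p_def algebra_simps power2_eq_square)
    then have "(p + p\<^sup>2) * r \<le> c"
      using IH r by (smt (verit) mult_right_mono r_def)
    then have le: "p * r + p * (p * r) \<le> c"
      by (simp add: algebra_simps power2_eq_square)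
    have "1 \<le> p * r"
    proof -
      have "p * (r + 1) \<le> 2 * (p * r)" using r p by (simp add: algebra_simps)
      then show ?thesis using big assms(2) by linarith
    qed
    then have "p \<le> p * (p * r)"
      using p by simp
    with le big show False by (simp add: algebra_simps)
  qed
qed

lemma Argmin_mem: "y \<in> Argmin S g \<Longrightarrow> y \<in> S"
  and Argmin_le: "y \<in> Argmin S g \<Longrightarrow> u \<in> S \<Longrightarrow> g y \<le> g u"
  by (simp_all add: Argmin_def)

section \<open>The composite problem in real-valued terms\<close>

text \<open>
  All iterates lie in the domain of \<open>h\<close>, where \<open>f\<close> and \<open>h\<close> are finite; \<open>F\<close>, \<open>H\<close> and \<open>cut\<close> are the
  real-valued versions of \<open>f\<close>, \<open>h\<close> and the cutting-plane model there.
\<close>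

locale composite = basic_assumptions +
  assumes convex_E: "convex E"
begin

abbreviation D where "D \<equiv> edom E h"

definition F where "F u = real_of_ereal (f u)"
definition H where "H u = real_of_ereal (h u)"

definition cut where "cut A u = Max ((\<lambda>y. F y + inner (f' y) (u - y)) ` A)"

lemma f_real: "u \<in> D \<Longrightarrow> f u = ereal (F u)"
  using dom_subset f(1) unfolding F_def proper_on_def edom_def
  by (subst ereal_real') auto

lemma h_real: "u \<in> D \<Longrightarrow> h u = ereal (H u)"
  using h(1) unfolding H_def proper_on_def edom_def
  by (subst ereal_real') auto

lemma objective_real: "u \<in> D \<Longrightarrow> objective f h u = ereal (F u + H u)"
  by (simp add: objective_def f_real h_real)

lemma D_convex_combination:
  assumes "y \<in> D" "u \<in> D" "0 \<le> s" "s \<le> 1"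
  shows "(1 - s) *\<^sub>R y + s *\<^sub>R u \<in> D" "H ((1 - s) *\<^sub>R y + s *\<^sub>R u) \<le> (1 - s) * H y + s * H u"
proof -
  let ?v = "(1 - s) *\<^sub>R y + s *\<^sub>R u"
  have "y \<in> E" "u \<in> E" using assms by (auto simp: edom_def)
  then have "h ((1 - s) *\<^sub>R y + (1 - (1 - s)) *\<^sub>R u) \<le> ereal (1 - s) * h y + ereal (1 - (1 - s)) * h u"
    using h(3) assms unfolding econvex_on_def
    by (metis atLeastAtMost_iff diff_ge_0_iff_ge diff_le_eq le_add_same_cancel1)
  then have *: "h ?v \<le> ereal ((1 - s) * H y + s * H u)"
    using assms by (simp add: h_real)
  moreover have "?v \<in> E"
    using convex_E assms \<open>y \<in> E\<close> \<open>u \<in> E\<close> by (simp add: convex_alt)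
  ultimately show "?v \<in> D"
    using order_le_less_trans[OF *] by (auto simp: edom_def)
  then show "H ?v \<le> (1 - s) * H y + s * H u"
    using * by (simp add: h_real)
qed

lemma convex_D: "convex D"
  unfolding convex_alt using D_convex_combination(1) by blast

lemma convex_H: "convex_on D H"
  by (rule convex_onI[OF _ convex_D]) (use D_convex_combination(2) in auto)

lemma subgradient_real:
  assumes "y \<in> D" "u \<in> D"
  shows "F y + inner (f' y) (u - y) \<le> F u"
  using subgradient[OF assms(1)] assms
  by (auto simp: subdifferential_def edom_def dest!: bspec[of _ _ u])
     (use assms in \<open>simp add: f_real\<close>)

lemma inner_subgradient_bound:
  "y \<in> D \<Longrightarrow> inner (f' y) v \<le> Mf * norm v" "y \<in> D \<Longrightarrow> - (Mf * norm v) \<le> inner (f' y) v"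
  using Cauchy_Schwarz_ineq2[of "f' y" v] mult_right_mono[OF subgradient_bound, of y "norm v"]
  by (force simp: abs_le_iff)+

text \<open>
  The subgradient inequality at \<open>u\<close> bounds \<open>F u - F y\<close> by \<open>Mf \<parallel>u - y\<parallel>\<close>; the linear term costs the
  same amount once more.
\<close>

lemma linearization_error:
  assumes "y \<in> D" "u \<in> D"
  shows "F u - (F y + inner (f' y) (u - y)) \<le> 2 * Mf * norm (u - y)"
  using subgradient_real[OF assms(2,1)] inner_subgradient_bound(1)[OF assms(2), of "u - y"]
    inner_subgradient_bound(2)[OF assms(1), of "u - y"] inner_minus_right[of "f' u" "u - y"]
  by simp

lemma cut_model_real:
  assumes "finite A" "A \<noteq> {}" "A \<subseteq> D"
  shows "cut_model f f' A u = ereal (cut A u)"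
proof -
  have "linearization f f' y u = ereal (F y + inner (f' y) (u - y))" if "y \<in> A" for y
    using that assms by (auto simp: linearization_def f_real)
  then have "(\<lambda>y. linearization f f' y u) ` A = ereal ` (\<lambda>y. F y + inner (f' y) (u - y)) ` A"
    by (auto simp: image_image)
  then show ?thesis
    unfolding cut_model_def cut_def using assms
    by (simp add: mono_Max_commute[of ereal] mono_def)
qed

lemma cut_ge: "finite A \<Longrightarrow> y \<in> A \<Longrightarrow> F y + inner (f' y) (u - y) \<le> cut A u"
  by (simp add: cut_def)

lemma cut_le: "finite A \<Longrightarrow> A \<noteq> {} \<Longrightarrow> A \<subseteq> D \<Longrightarrow> u \<in> D \<Longrightarrow> cut A u \<le> F u"
  using subgradient_real by (auto simp: cut_def)

lemma cut_mono: "A \<noteq> {} \<Longrightarrow> A \<subseteq> A' \<Longrightarrow> finite A' \<Longrightarrow> cut A u \<le> cut A' u"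
  unfolding cut_def by (intro Max_mono) auto

lemma convex_cut: "finite A \<Longrightarrow> A \<noteq> {} \<Longrightarrow> convex_on D (cut A)"
  unfolding cut_def[abs_def] by (intro convex_on_Max_affine convex_D)

lemma active_set_real:
  assumes "finite A" "A \<noteq> {}" "A \<subseteq> D"
  shows "active_set f f' A u = {y \<in> A. F y + inner (f' y) (u - y) = cut A u}"
  unfolding active_set_def cut_model_real[OF assms] linearization_def
  using assms(3) by (auto simp: f_real subset_iff)

lemma active_set_nonempty:
  assumes "finite A" "A \<noteq> {}" "A \<subseteq> D"
  shows "active_set f f' A u \<noteq> {}"
proof -
  have "cut A u \<in> (\<lambda>y. F y + inner (f' y) (u - y)) ` A"
    unfolding cut_def using assms by (intro Max_in) auto
  then show ?thesis
    unfolding active_set_real[OF assms] by auto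
qed

lemma model_objective_real:
  assumes "finite A" "A \<noteq> {}" "A \<subseteq> D" "u \<in> D"
  shows "model_objective f f' h lam A c u = ereal (cut A u + H u + 1 / (2 * lam) * (norm (u - c))\<^sup>2)"
  unfolding model_objective_def prox_term_def using assms by (simp add: cut_model_real h_real)

lemma prox_objective_real:
  assumes "u \<in> D"
  shows "prox_objective f h lam c u = ereal (F u + H u + 1 / (2 * lam) * (norm (u - c))\<^sup>2)"
  unfolding prox_objective_def prox_term_def using assms by (simp add: objective_real)

lemma model_minimizer_in_domain:
  assumes A: "finite A" "A \<noteq> {}" "A \<subseteq> D"
    and y: "y \<in> Argmin E (model_objective f f' h lam A c)"
  shows "y \<in> D"
proof -
  obtain p where p: "p \<in> A" using A by auto
  then have "p \<in> D" "p \<in> E" using A by (auto simp: edom_def)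
  then have le: "model_objective f f' h lam A c y \<le> model_objective f f' h lam A c p"
    using y by (auto simp: Argmin_def)
  have "h y \<noteq> \<infinity>"
  proof
    assume "h y = \<infinity>"
    then show False
      using le \<open>p \<in> D\<close> A
      unfolding model_objective_real[OF A \<open>p \<in> D\<close>]
      by (simp add: model_objective_def cut_model_real prox_term_def)
  qed
  then show ?thesis
    using y by (simp add: Argmin_def edom_def)
qed

text \<open>
  Dropping the inactive cuts does not change the model near its minimizer \<open>y\<close>, so \<open>y\<close> remains a
  minimizer along segments and the quadratic growth holds for the smaller model as well. This is
  why a null iteration may discard every inactive cut without losing model value.
\<close>

lemma model_growth:
  assumes A: "finite A" "A \<noteq> {}" "A \<subseteq> D"
    and y: "y \<in> Argmin E (model_objective f f' h lam A c)" and u: "u \<in> D"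
  shows "cut A y + H y + 1 / (2 * lam) * (norm (y - c))\<^sup>2 + 1 / (2 * lam) * (norm (u - y))\<^sup>2
    \<le> cut (active_set f f' A y) u + H u + 1 / (2 * lam) * (norm (u - c))\<^sup>2"
proof -
  let ?A = "active_set f f' A y"
  have yD: "y \<in> D" by (rule model_minimizer_in_domain[OF A y])
  have fin: "finite ?A" and ne: "?A \<noteq> {}"
    using A active_set_nonempty[OF A] by (auto simp: active_set_def)
  have seg: "y + s *\<^sub>R (u - y) \<in> D" if "0 < s" "s < 1" for s
    using D_convex_combination(1)[OF yD u, of s] that by (simp add: algebra_simps)
  have cut_y: "cut ?A y = cut A y"
  proof -
    obtain p where p: "p \<in> ?A" using ne by auto
    then have "cut A y \<le> cut ?A y"
      using cut_ge[OF fin p, of y] by (simp add: active_set_real[OF A])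
    moreover have "cut ?A y \<le> cut A y"
      using A ne by (intro cut_mono) (auto simp: active_set_def)
    ultimately show ?thesis by simp
  qed
  have ev: "\<forall>\<^sub>F s in at_right 0. cut ?A (y + s *\<^sub>R (u - y)) = cut A (y + s *\<^sub>R (u - y))"
    unfolding cut_def
    by (rule Max_affine_active_eventually_eq)
      (use A active_set_real[OF A] in \<open>auto simp: cut_def\<close>)
  have "\<forall>\<^sub>F s in at_right 0. cut ?A y + H y + 1 / (2 * lam) * (norm (y - c))\<^sup>2
      \<le> cut ?A (y + s *\<^sub>R (u - y)) + H (y + s *\<^sub>R (u - y))
        + 1 / (2 * lam) * (norm (y + s *\<^sub>R (u - y) - c))\<^sup>2"
    using ev eventually_at_right_real[OF zero_less_one]
  proof eventually_elim
    case (elim s)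
    let ?v = "y + s *\<^sub>R (u - y)"
    have v: "?v \<in> D" using seg elim by simp
    then have "model_objective f f' h lam A c y \<le> model_objective f f' h lam A c ?v"
      using y by (auto simp: Argmin_def edom_def)
    then show ?case
      using elim v yD A by (simp add: model_objective_real cut_y)
  qed
  from quadratic_growth[OF convex_on_add[OF convex_cut[OF fin ne] convex_H] yD u this]
  show ?thesis by (simp add: cut_y)
qed

lemma minimizer_in_domain: "xs \<in> opt_set E f h \<Longrightarrow> xs \<in> D"
proof -
  assume xs: "xs \<in> opt_set E f h"
  obtain p where p: "p \<in> D" using h(1) by (auto simp: proper_on_def)
  have "objective f h xs \<le> objective f h p" "xs \<in> E"
    using xs p by (auto simp: opt_set_def Argmin_def edom_def)
  moreover have "f xs \<noteq> -\<infinity>" using f(1) \<open>xs \<in> E\<close> by (simp add: proper_on_def)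
  ultimately have "h xs \<noteq> \<infinity>"
    using objective_real[OF p] by (auto simp: objective_def)
  then show "xs \<in> D" using \<open>xs \<in> E\<close> by (simp add: edom_def)
qed

lemma opt_value_real:
  assumes "xs \<in> opt_set E f h"
  shows "opt_value E f h = ereal (F xs + H xs)"
proof -
  have "opt_value E f h = objective f h xs"
    unfolding opt_value_def using assms
    by (intro antisym INF_lower INF_greatest) (auto simp: opt_set_def Argmin_def)
  then show ?thesis
    using objective_real[OF minimizer_in_domain[OF assms]] by simp
qed

text \<open>
  The infimum that defines the distance to the optimal set is only approximated here, which is
  enough because the number of serious iterations is bounded by a strict inequality.
\<close>

lemma exists_near_minimizer:
  assumes "opt_dist E f h p < r"
  shows "\<exists>xs\<in>opt_set E f h. norm (p - xs) < r"
  using assms opt_set_nonempty unfolding opt_dist_def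
  by (subst (asm) cINF_less_iff) (auto intro!: bdd_belowI2[where m = 0])

lemma opt_dist_nonneg: "0 \<le> opt_dist E f h p"
  unfolding opt_dist_def using opt_set_nonempty by (intro cINF_greatest) auto

end

section \<open>Null and serious iterations\<close>

text \<open>
  The number \<open>L\<close> bounds the ratio of the Lipschitz constant of \<open>h\<close> to \<open>Mf\<close>; with it all estimates
  below involve \<open>Mf\<close> alone.
\<close>

locale composite_run = composite E f f' h Mf Mh mu +
  rpb_run E f f' h x0 lam delta x xc xt zh B k m t
  for E :: "'a::real_inner set" and f f' h Mf Mh mu x0 lam delta x xc xt zh B k m t +
  fixes L :: real
  assumes Mf_pos: "0 < Mf" and L_nonneg: "0 \<le> L" and Mh_le: "Mh \<le> ereal (L * Mf)"
begin

lemma H_lipschitz: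
  assumes "u \<in> D" "v \<in> D"
  shows "\<bar>H u - H v\<bar> \<le> L * Mf * norm (u - v)"
proof -
  have "ereal \<bar>H u - H v\<bar> \<le> Mh * ereal (norm (u - v))"
    using h_lipschitz[OF assms] assms by (simp add: h_real)
  also have "\<dots> \<le> ereal (L * Mf) * ereal (norm (u - v))"
    using Mh_le by (intro ereal_mult_right_mono) auto
  finally show ?thesis by simp
qed

lemma run_in_domain:
  assumes "1 \<le> j"
  shows "finite (B j) \<and> B j \<noteq> {} \<and> B j \<subseteq> D \<and> x ` {0..<j} \<subseteq> D \<and> xt (j - 1) \<in> D \<and> xc (j - 1) \<in> D"
  using assms
proof (induction j rule: dec_induct)
  case base
  have "x ` {0..<1} = {x0}" using init by auto
  then show ?case unfolding init using init input by simp
next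
  case (step j)
  then have B: "finite (B j)" "B j \<noteq> {}" "B j \<subseteq> D" by blast+
  have xj: "x j \<in> D"
    using iterate[OF step(1)] by (intro model_minimizer_in_domain[OF B]) (rule equalityD2[THEN subsetD], auto)
  have "{x j, xt (j - 1)} \<subseteq> D"
    using xj step.IH by simp
  then have xtj: "xt j \<in> D"
    by (rule subsetD[OF _ Argmin_mem[OF tilde[OF step(1)]]])
  have xs: "x ` {0..j} \<subseteq> D"
  proof -
    have "{0..j} = insert j {0..<j}" by auto
    then show ?thesis using step.IH xj by simp
  qed
  then have xs': "x ` {0..<Suc j} \<subseteq> D"
    by (simp add: atLeastLessThanSuc_atLeastAtMost)
  have "finite (B (Suc j)) \<and> x j \<in> B (Suc j) \<and> B (Suc j) \<subseteq> D \<and> xc j \<in> D"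
  proof (cases "t j \<le> ereal delta")
    case True
    have "finite (B (Suc j))" "x j \<in> B (Suc j)" "B (Suc j) \<subseteq> x ` {0..j}" "xc j = x j"
      using serious[OF step(1) True] by simp_all
    with xs xj show ?thesis
      by (simp add: subset_trans[OF _ xs])
  next
    case False
    have n: "x j \<in> B (Suc j)" "B (Suc j) \<subseteq> B j \<union> {x j}" "xc j = xc (j - 1)"
      using null[OF step(1) False] by simp_all
    have "finite (B (Suc j))"
      by (rule finite_subset[OF n(2)]) (use B in simp)
    moreover have "B (Suc j) \<subseteq> D" using n(2) B(3) xj by blast
    moreover have "xc j \<in> D" unfolding n(3) using step.IH by blast
    ultimately show ?thesis using n(1) by blast
  qed
  then show ?case using xtj xs' unfolding diff_Suc_1 by blast
qed

lemma
  assumes "1 \<le> j"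
  shows finite_B: "finite (B j)" and B_nonempty: "B j \<noteq> {}" and B_subset: "B j \<subseteq> D"
    and center_in: "xc (j - 1) \<in> D"
  using run_in_domain[OF assms] by blast+

lemma x_in: "x j \<in> D" and xt_in: "xt j \<in> D"
proof -
  have "x ` {0..<j + 1} \<subseteq> D" "xt (j + 1 - 1) \<in> D"
    using run_in_domain[of "j + 1"] by simp_all
  then show "x j \<in> D" "xt j \<in> D"
    by (auto simp: image_subset_iff)
qed

lemma x_argmin: "1 \<le> j \<Longrightarrow> x j \<in> Argmin E (model_objective f f' h lam (B j) (xc (j - 1)))"
  using iterate[of j] by simp

definition prox_value where
  "prox_value j u = F u + H u + 1 / (2 * lam) * (norm (u - xc (j - 1)))\<^sup>2"

definition T where
  "T j = prox_value j (xt j)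
     - (cut (B j) (x j) + H (x j) + 1 / (2 * lam) * (norm (x j - xc (j - 1)))\<^sup>2)"

lemma t_real:
  assumes "1 \<le> j"
  shows "t j = ereal (T j)"
proof -
  let ?g = "model_objective f f' h lam (B j) (xc (j - 1))"
  have min: "?g (x j) \<le> ?g u" if "u \<in> E" for u
    by (rule Argmin_le[OF x_argmin[OF assms] that])
  have "x j \<in> E"
    using x_in[of j] by (simp add: edom_def)
  then have "(INF u\<in>E. ?g u) = ?g (x j)"
    using min by (intro antisym INF_lower INF_greatest)
  then have "m j = ereal (cut (B j) (x j) + H (x j) + 1 / (2 * lam) * (norm (x j - xc (j - 1)))\<^sup>2)"
    using model_value[OF assms]
      model_objective_real[OF finite_B[OF assms] B_nonempty[OF assms] B_subset[OF assms] x_in]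
    by presburger
  then show ?thesis
    unfolding gap[OF assms] prox_objective_real[OF xt_in] T_def prox_value_def by simp
qed

lemma prox_value_xt_le:
  assumes "1 \<le> j"
  shows "prox_value j (xt j) \<le> prox_value j (x j)" "prox_value j (xt j) \<le> prox_value j (xt (j - 1))"
proof -
  have "prox_objective f h lam (xc (j - 1)) (xt j) \<le> prox_objective f h lam (xc (j - 1)) u"
    if "u \<in> {x j, xt (j - 1)}" for u
    by (rule Argmin_le[OF tilde[OF assms] that])
  from this[of "x j"] this[of "xt (j - 1)"]
  show "prox_value j (xt j) \<le> prox_value j (x j)" "prox_value j (xt j) \<le> prox_value j (xt (j - 1))"
    unfolding prox_objective_real[OF x_in] prox_objective_real[OF xt_in] prox_value_def by simp_all
qed

text \<open>
  The best value \<open>prox_value j (xt j)\<close> is at most the one at \<open>x j\<close>, so the gap is at most the error of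
  the model at \<open>x j\<close>, hence at most the error of any single cut of the bundle.
\<close>

lemma gap_le_step:
  assumes "1 \<le> j" "y \<in> B j"
  shows "T j \<le> 2 * Mf * norm (x j - y)"
proof -
  have "T j \<le> F (x j) - cut (B j) (x j)"
    using prox_value_xt_le(1)[OF assms(1)] by (simp add: T_def prox_value_def)
  also have "\<dots> \<le> F (x j) - (F y + inner (f' y) (x j - y))"
    using cut_ge[OF finite_B[OF assms(1)] assms(2), of "x j"] by simp
  also have "\<dots> \<le> 2 * Mf * norm (x j - y)"
    using assms B_subset by (intro linearization_error x_in) auto
  finally show ?thesis .
qed

text \<open>
  The prox-center is unchanged, so the best value cannot increase, and the model value rises
  because the next bundle keeps all active cuts.
\<close>

lemma gap_after_null:
  assumes j: "1 \<le> j" and nul: "\<not> t j \<le> ereal delta"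
  shows "T (j + 1) + 1 / (2 * lam) * (norm (x (j + 1) - x j))\<^sup>2 \<le> T j"
    and "T (j + 1) \<le> 2 * Mf * norm (x (j + 1) - x j)"
proof -
  note n = null[OF j nul]
  note Bj = finite_B[OF j] B_nonempty[OF j] B_subset[OF j]
  have "cut (active_set f f' (B j) (x j)) (x (j + 1)) \<le> cut (B (j + 1)) (x (j + 1))"
    using n active_set_nonempty[OF Bj] finite_B[of "j + 1"] by (intro cut_mono) auto
  moreover have "prox_value (j + 1) (xt (j + 1)) \<le> prox_value j (xt j)"
    using prox_value_xt_le(2)[of "j + 1"] n by (simp add: prox_value_def)
  ultimately show "T (j + 1) + 1 / (2 * lam) * (norm (x (j + 1) - x j))\<^sup>2 \<le> T j"
    using model_growth[OF Bj x_argmin[OF j] x_in[of "j + 1"]] n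
    by (simp add: T_def)
  show "T (j + 1) \<le> 2 * Mf * norm (x (j + 1) - x j)"
    using n by (intro gap_le_step) auto
qed

lemma gap_recursion:
  assumes "1 \<le> j" "\<not> t j \<le> ereal delta" and nonneg: "0 \<le> T (j + 1)"
  shows "T (j + 1) + 1 / (8 * lam * Mf\<^sup>2) * (T (j + 1))\<^sup>2 \<le> T j"
proof -
  have "(T (j + 1))\<^sup>2 \<le> (2 * Mf * norm (x (j + 1) - x j))\<^sup>2"
    using gap_after_null(2)[OF assms(1,2)] nonneg by (rule power_mono)
  then have "1 / (8 * lam * Mf\<^sup>2) * (T (j + 1))\<^sup>2
      \<le> 1 / (8 * lam * Mf\<^sup>2) * (2 * Mf * norm (x (j + 1) - x j))\<^sup>2"
    using input(2) by (intro mult_left_mono) auto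
  also have "\<dots> = 1 / (2 * lam) * (norm (x (j + 1) - x j))\<^sup>2"
    using input(2) Mf_pos by (simp add: field_simps power2_eq_square)
  finally show ?thesis
    using gap_after_null(1)[OF assms(1,2)] by linarith
qed

text \<open>
  At the start of a cycle the bundle contains a cut at the prox-center \<open>c\<close>. The model loses at most
  \<open>(1 + L) Mf \<parallel>x j - c\<parallel>\<close> between \<open>c\<close> and \<open>x j\<close>, whereas the proximal term and the growth of the model
  charge \<open>\<parallel>x j - c\<parallel>\<^sup>2 / \<lambda>\<close>. Thus \<open>x j\<close> is within \<open>(1 + L) \<lambda> Mf\<close> of \<open>c\<close>, and the error of the cut at \<open>c\<close>
  bounds the gap.
\<close>

lemma gap_bound_cycle_start:
  assumes j: "1 \<le> j" and start: "xc (j - 1) \<in> B j"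
  shows "T j \<le> 2 * (1 + L) * lam * Mf\<^sup>2"
proof -
  define c where "c = xc (j - 1)"
  define r where "r = norm (x j - c)"
  note Bj = finite_B[OF j] B_nonempty[OF j] B_subset[OF j]
  have cD: "c \<in> D" using center_in[OF j] by (simp add: c_def)
  have "cut (active_set f f' (B j) (x j)) c \<le> cut (B j) c"
    using active_set_nonempty[OF Bj] Bj by (intro cut_mono) (auto simp: active_set_def)
  also have "\<dots> \<le> F c" using Bj cD by (intro cut_le)
  finally have "cut (B j) (x j) + H (x j) + 1 / (2 * lam) * r\<^sup>2 + 1 / (2 * lam) * r\<^sup>2 \<le> F c + H c"
    using model_growth[OF Bj x_argmin[OF j] cD]
    unfolding c_def[symmetric] r_def norm_minus_commute[of c "x j"] by simp
  moreover have "F c - Mf * r \<le> cut (B j) (x j)"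
    using cut_ge[OF Bj(1), of c "x j"] start inner_subgradient_bound(2)[OF cD, of "x j - c"]
    unfolding c_def[symmetric] r_def by simp
  moreover have "H c - H (x j) \<le> L * Mf * r"
    using H_lipschitz[OF cD x_in, of j] by (simp add: r_def norm_minus_commute)
  ultimately have "1 / (2 * lam) * r\<^sup>2 + 1 / (2 * lam) * r\<^sup>2 \<le> (1 + L) * Mf * r"
    by (simp add: algebra_simps)
  then have "r * r \<le> lam * (1 + L) * Mf * r"
    using input(2) by (simp add: field_simps power2_eq_square)
  moreover have "0 \<le> lam * (1 + L) * Mf" "0 \<le> r"
    using input(2) Mf_pos L_nonneg by (auto simp: r_def)
  ultimately have r: "r \<le> lam * (1 + L) * Mf"
    by (cases "r = 0") auto
  have "T j \<le> 2 * Mf * r"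
    using gap_le_step[OF j start] by (simp add: r_def c_def)
  also have "\<dots> \<le> 2 * Mf * (lam * (1 + L) * Mf)"
    using r Mf_pos by simp
  finally show ?thesis by (simp add: power2_eq_square algebra_simps)
qed

text \<open>
  Gaps do not increase along null iterations, so the bound for the start of a cycle holds
  throughout. In this way runs of null iterations can be estimated from any
  starting point, without locating the beginning of the cycle.
\<close>

lemma gap_bound:
  assumes "1 \<le> j"
  shows "T j \<le> 2 * (1 + L) * lam * Mf\<^sup>2"
  using assms
proof (induction j rule: dec_induct)
  case base
  show ?case using init by (intro gap_bound_cycle_start) auto
next
  case (step j)
  show ?case
  proof (cases "t j \<le> ereal delta")
    case True
    then show ?thesis using serious[of j] step by (intro gap_bound_cycle_start) auto
  next
    case False
    have "0 \<le> 1 / (2 * lam) * (norm (x (j + 1) - x j))\<^sup>2" using input(2) by simp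
    then show ?thesis using gap_after_null(1)[of j] False step by simp
  qed
qed

text \<open>
  With \<open>a = 1 / (8 \<lambda> Mf\<^sup>2)\<close> the initial value satisfies \<open>a T \<le> (1 + L) / 4\<close>; the constant \<open>2 + L\<close>
  is at least this and at least the \<open>2\<close> required for harmonic decay. The last gap of the run is still above
  \<open>delta\<close>, which limits the length.
\<close>

lemma null_run_length:
  assumes j: "1 \<le> j" and nulls: "\<And>i. i \<le> n \<Longrightarrow> \<not> t (j + i) \<le> ereal delta"
  shows "real n + 1 < 8 * (2 + L) * lam * Mf\<^sup>2 / delta"
proof -
  define a where "a = 1 / (8 * lam * Mf\<^sup>2)"
  have a: "0 < a" using input(2) Mf_pos by (simp add: a_def)
  have "a * T (j + n) * (real n + 1) \<le> 2 + L"
  proof (rule harmonic_decay[where T = "\<lambda>i. T (j + i)"])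
    have "a * T j \<le> a * (2 * (1 + L) * lam * Mf\<^sup>2)"
      using gap_bound[OF j] a by simp
    also have "\<dots> = (1 + L) / 4"
      using input(2) Mf_pos by (simp add: a_def)
    finally show "a * T (j + 0) \<le> 2 + L" using L_nonneg by simp
    show "T (j + Suc i) + a * (T (j + Suc i))\<^sup>2 \<le> T (j + i)" if "i < n" "0 \<le> T (j + Suc i)" for i
      using gap_recursion[of "j + i"] nulls[of i] j that by (simp add: a_def)
  qed (use a L_nonneg in auto)
  moreover have "delta < T (j + n)"
    using nulls[of n] t_real[of "j + n"] j by simp
  then have "a * delta * (real n + 1) < a * T (j + n) * (real n + 1)"
    using a by simp
  ultimately have "a * delta * (real n + 1) < 2 + L" by linarith
  then show ?thesis
    using input(2,3) Mf_pos by (simp add: a_def field_simps)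
qed

text \<open>
  The model minorizes the objective, so its quadratic growth can be tested at any \<open>u\<close> of the domain;
  a gap of at most \<open>delta\<close> transfers the estimate to \<open>xt j\<close>, and the new prox-center is \<open>x j\<close>.
\<close>

lemma serious_estimate:
  assumes j: "1 \<le> j" and ser: "t j \<le> ereal delta" and u: "u \<in> D"
  shows "F (xt j) + H (xt j) + 1 / (2 * lam) * (norm (u - xc j))\<^sup>2
    \<le> F u + H u + delta + 1 / (2 * lam) * (norm (u - xc (j - 1)))\<^sup>2"
proof -
  note Bj = finite_B[OF j] B_nonempty[OF j] B_subset[OF j]
  have "cut (active_set f f' (B j) (x j)) u \<le> cut (B j) u"
    using active_set_nonempty[OF Bj] Bj by (intro cut_mono) (auto simp: active_set_def)
  also have "\<dots> \<le> F u" using Bj u by (intro cut_le)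
  finally have "cut (active_set f f' (B j) (x j)) u \<le> F u" .
  moreover have "T j \<le> delta" using ser t_real[OF j] by simp
  moreover have "0 \<le> 1 / (2 * lam) * (norm (xt j - xc (j - 1)))\<^sup>2" using input(2) by simp
  moreover have "xc j = x j" using serious[OF j ser] by simp
  ultimately show ?thesis
    using model_growth[OF Bj x_argmin[OF j] u] by (simp add: T_def prox_value_def)
qed

text \<open>
  As long as no serious iteration is \<open>eps\<close>-optimal, the squared distance from the prox-center to the
  minimizer never increases, and it drops by \<open>2 lam (eps - delta)\<close> at each serious iteration. Every
  block of \<open>W\<close> consecutive iterations contains one of these. Measuring progress by this distance
  makes it unnecessary to count cycles.
\<close>

lemma center_distance_decrease:
  assumes xs: "xs \<in> D" and W: "8 * (2 + L) * lam * Mf\<^sup>2 / delta \<le> real W" "1 \<le> W"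
    and bad: "\<And>i. 1 \<le> i \<Longrightarrow> i \<le> q * W \<Longrightarrow> t i \<le> ereal delta \<Longrightarrow>
      F xs + H xs + eps < F (xt i) + H (xt i)"
    and eps: "delta \<le> eps"
  shows "(norm (xs - xc (q * W)))\<^sup>2 + 2 * lam * (eps - delta) * real q \<le> (norm (xs - x0))\<^sup>2"
proof -
  let ?V = "\<lambda>i. (norm (xs - xc i))\<^sup>2"
  have drop: "?V i + 2 * lam * (eps - delta) \<le> ?V (i - 1)"
    if "1 \<le> i" "i \<le> q * W" "t i \<le> ereal delta" for i
  proof -
    have "eps - delta + 1 / (2 * lam) * ?V i \<le> 1 / (2 * lam) * ?V (i - 1)"
      using serious_estimate[OF that(1,3) xs] bad[OF that] by linarith
    then have "2 * lam * (eps - delta + 1 / (2 * lam) * ?V i) \<le> 2 * lam * (1 / (2 * lam) * ?V (i - 1))"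
      using input(2) by (intro mult_left_mono) auto
    then show ?thesis using input(2) by (simp add: distrib_left)
  qed
  have mono1: "?V (i + 1) \<le> ?V i" if "i + 1 \<le> q * W" for i
  proof (cases "t (i + 1) \<le> ereal delta")
    case True
    have "0 \<le> 2 * lam * (eps - delta)" using input(2) eps by simp
    moreover have "?V (i + 1) + 2 * lam * (eps - delta) \<le> ?V i"
      using drop[of "i + 1"] True that by simp
    ultimately show ?thesis by linarith
  next
    case False
    then show ?thesis using null[of "i + 1"] by simp
  qed
  have mono: "?V i' \<le> ?V i" if "i \<le> i'" "i' \<le> q * W" for i i'
    using that
  proof (induction i' rule: dec_induct)
    case (step n)
    then show ?case using mono1[of n] by simp
  qed simp
  have "p \<le> q \<Longrightarrow> ?V (p * W) + 2 * lam * (eps - delta) * real p \<le> (norm (xs - x0))\<^sup>2" for p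
  proof (induction p)
    case 0
    then show ?case using init by simp
  next
    case (Suc p)
    have end_le: "Suc p * W \<le> q * W" using Suc.prems by (intro mult_right_mono) auto
    have "\<exists>i\<le>W - 1. t (p * W + 1 + i) \<le> ereal delta"
    proof (rule ccontr)
      assume "\<not> ?thesis"
      then have "real (W - 1) + 1 < 8 * (2 + L) * lam * Mf\<^sup>2 / delta"
        by (intro null_run_length[of "p * W + 1"]) auto
      then show False using W by simp
    qed
    then obtain i where i: "i \<le> W - 1" "t (p * W + 1 + i) \<le> ereal delta" by blast
    define l where "l = p * W + 1 + i"
    have l: "1 \<le> l" "l \<le> Suc p * W" "p * W \<le> l - 1" using i(1) W(2) by (auto simp: l_def)
    have "?V (Suc p * W) + 2 * lam * (eps - delta) \<le> ?V l + 2 * lam * (eps - delta)"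
      using mono[of l "Suc p * W"] l end_le by simp
    also have "\<dots> \<le> ?V (l - 1)" using drop[of l] i(2) l end_le by (simp add: l_def)
    also have "\<dots> \<le> ?V (p * W)" using l end_le by (intro mono) auto
    finally show ?case using Suc by (simp add: algebra_simps)
  qed
  from this[of q] show ?thesis by simp
qed

lemma iteration_count:
  assumes eps: "delta < eps"
    and W: "8 * (2 + L) * lam * Mf\<^sup>2 / delta \<le> real W" "1 \<le> W"
    and q: "(opt_dist E f h x0)\<^sup>2 < 2 * lam * (eps - delta) * real q"
  shows "\<exists>j i. j \<le> q * W \<and> i < k (j + 1) \<and> objective f h (zh i) - opt_value E f h \<le> ereal eps"
proof -
  have "opt_dist E f h x0 < sqrt (2 * lam * (eps - delta) * real q)"
    using q by (rule real_less_rsqrt)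
  then obtain xs where xs: "xs \<in> opt_set E f h" "norm (x0 - xs) < sqrt (2 * lam * (eps - delta) * real q)"
    using exists_near_minimizer by blast
  have "(norm (x0 - xs))\<^sup>2 < (sqrt (2 * lam * (eps - delta) * real q))\<^sup>2"
    using xs(2) by (intro power_strict_mono) auto
  then have near: "(norm (xs - x0))\<^sup>2 < 2 * lam * (eps - delta) * real q"
    using input(2) eps by (simp add: norm_minus_commute)
  have "\<exists>j. 1 \<le> j \<and> j \<le> q * W \<and> t j \<le> ereal delta \<and> F (xt j) + H (xt j) \<le> F xs + H xs + eps"
  proof (rule ccontr)
    assume "\<not> ?thesis"
    then have "(norm (xs - xc (q * W)))\<^sup>2 + 2 * lam * (eps - delta) * real q \<le> (norm (xs - x0))\<^sup>2"
      using eps minimizer_in_domain[OF xs(1)] W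
      by (intro center_distance_decrease) force+
    then show False using near zero_le_power2[of "norm (xs - xc (q * W))"] by linarith
  qed
  then obtain j where j: "1 \<le> j" "j \<le> q * W" "t j \<le> ereal delta"
    and good: "F (xt j) + H (xt j) \<le> F xs + H xs + eps" by blast
  have "zh (k j) \<in> Argmin {zh (k j - 1), xt j} (objective f h)" "k j < k (j + 1)"
    using serious[OF j(1,3)] by simp_all
  then have "objective f h (zh (k j)) \<le> objective f h (xt j)"
    by (intro Argmin_le) auto
  moreover have "objective f h (xt j) \<le> ereal (F xs + H xs + eps)"
    using good by (simp add: objective_real xt_in)
  ultimately have "objective f h (zh (k j)) \<le> ereal (F xs + H xs + eps)" by order
  then have "objective f h (zh (k j)) - opt_value E f h \<le> ereal eps"
    unfolding opt_value_real[OF xs(1)]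
    by (cases "objective f h (zh (k j))") auto
  with j(2) \<open>k j < k (j + 1)\<close> show ?thesis by blast
qed

end

section \<open>The complexity bound\<close>

text \<open>
  With \<open>p = d\<^sup>2 / (lam e)\<close> and \<open>q = lam M\<^sup>2 / e\<close> the bounds on \<open>lam\<close> read \<open>1 \<le> C p\<close> and \<open>1 \<le> C q\<close>.
  They absorb the additive ones into the factors, and \<open>p q = M\<^sup>2 d\<^sup>2 / e\<^sup>2\<close> is free of \<open>lam\<close>.
\<close>

lemma stepsize_window_count_bound:
  fixes C L M d e lam :: real
  assumes C: "0 < C" and L: "0 \<le> L" and M: "0 < M" and e: "0 < e"
    and lam: "e / (C * M\<^sup>2) \<le> lam" "lam \<le> C * d\<^sup>2 / e"
  shows "(d\<^sup>2 / (lam * e) + 1) * (16 * (2 + L) * lam * M\<^sup>2 / e + 1)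
    \<le> (1 + C) * (16 * (2 + L) + C) * (1 + M\<^sup>2 * d\<^sup>2 / e\<^sup>2)"
proof -
  define p q where "p = d\<^sup>2 / (lam * e)" and "q = lam * M\<^sup>2 / e"
  have "0 < e / (C * M\<^sup>2)" using C M e by simp
  then have lam_pos: "0 < lam" using lam(1) by linarith
  have p: "1 \<le> C * p" using lam(2) lam_pos e by (simp add: p_def field_simps)
  have q: "1 \<le> C * q" using lam(1) C M e by (simp add: q_def field_simps)
  have "0 \<le> p" "0 \<le> q" using lam_pos e by (auto simp: p_def q_def)
  have "(p + 1) * (16 * (2 + L) * q + 1) \<le> ((1 + C) * p) * ((16 * (2 + L) + C) * q)"
    using p q L \<open>0 \<le> p\<close> \<open>0 \<le> q\<close> by (intro mult_mono) (auto simp: algebra_simps)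
  also have "\<dots> = (1 + C) * (16 * (2 + L) + C) * (p * q)" by simp
  also have "\<dots> \<le> (1 + C) * (16 * (2 + L) + C) * (1 + p * q)"
    using C L by (intro mult_left_mono) auto
  finally show ?thesis
    using lam_pos by (simp add: p_def q_def power2_eq_square mult_ac)
qed

theorem corollary3p3:
  fixes C C' :: real
  assumes "C > 0" and "C' > 0"
  shows "\<exists>K::real. \<forall>(n::nat) (eps::real) (f :: vec0 \<Rightarrow> ereal) f' h x0 Mf Mh mu d0.
    eps > 0 \<longrightarrow>
    basic_assumptions (Rn n) f f' h Mf Mh mu \<longrightarrow>
    x0 \<in> edom (Rn n) h \<longrightarrow>
    d0 = opt_dist (Rn n) f h x0 \<longrightarrow>
    C * Mf * d0 / eps \<ge> 1 \<longrightarrow>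
    Mh \<le> ereal (C' * Mf) \<longrightarrow>
    mu = 0 \<longrightarrow>
      {eps / (C * Mf\<^sup>2) .. C * d0\<^sup>2 / eps} \<noteq> {} \<and>
      (\<forall>lam \<in> {eps / (C * Mf\<^sup>2) .. C * d0\<^sup>2 / eps}.
        rpb_iteration_bound (Rn n) f f' h x0 lam (eps / 2) eps
          (K * (1 + Mf\<^sup>2 * d0\<^sup>2 / eps\<^sup>2)))"
proof (intro exI[of _ "(1 + C) * (16 * (2 + C') + C)"] allI impI conjI ballI)
  fix n :: nat and eps :: real and f :: "vec0 \<Rightarrow> ereal" and f' h x0 Mf Mh mu d0
  assume eps: "eps > 0" and ba: "basic_assumptions (Rn n) f f' h Mf Mh mu"
    and x0: "x0 \<in> edom (Rn n) h" and d0: "d0 = opt_dist (Rn n) f h x0"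
    and large: "C * Mf * d0 / eps \<ge> 1" and Mh: "Mh \<le> ereal (C' * Mf)" and "mu = 0"
  interpret composite "Rn n" f f' h Mf Mh mu
    by (intro composite.intro composite_axioms.intro ba subspace_imp_convex subspace_Rn)
  have "0 \<le> d0" using opt_dist_nonneg d0 by simp
  have "Mf \<noteq> 0" using large by auto
  with parameters have Mf: "0 < Mf" by simp
  have large': "eps \<le> C * Mf * d0" using large eps by simp
  show "{eps / (C * Mf\<^sup>2) .. C * d0\<^sup>2 / eps} \<noteq> {}"
  proof -
    have "eps * eps \<le> (C * Mf * d0) * (C * Mf * d0)"
      using large' eps by (intro mult_mono) auto
    then have "eps / (C * Mf\<^sup>2) \<le> C * d0\<^sup>2 / eps"
      using eps Mf assms by (simp add: field_simps power2_eq_square)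
    then show ?thesis by simp
  qed
  fix lam assume lam: "lam \<in> {eps / (C * Mf\<^sup>2) .. C * d0\<^sup>2 / eps}"
  show "rpb_iteration_bound (Rn n) f f' h x0 lam (eps / 2) eps
      ((1 + C) * (16 * (2 + C') + C) * (1 + Mf\<^sup>2 * d0\<^sup>2 / eps\<^sup>2))"
    unfolding rpb_iteration_bound_def
  proof (intro allI impI)
    fix x xc xt zh B k m t
    assume run: "rpb_run (Rn n) f f' h x0 lam (eps / 2) x xc xt zh B k m t"
    interpret composite_run "Rn n" f f' h Mf Mh mu x0 lam "eps / 2" x xc xt zh B k m t C'
      using run Mf Mh assms(2)
      by (intro composite_run.intro composite_run_axioms.intro composite_axioms) auto
    \<comment> \<open>\<open>w\<close> is the bound on the length of a run of null iterations for \<open>delta = eps / 2\<close>; \<open>p\<close> is the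
      bound on the number of serious iterations. Adding \<open>1\<close> to the floor of \<open>p\<close> makes the latter
      strict.\<close>
    define w where "w = 16 * (2 + C') * lam * Mf\<^sup>2 / eps"
    define p where "p = d0\<^sup>2 / (lam * eps)"
    define W where "W = nat \<lceil>w\<rceil>"
    define q where "q = nat \<lfloor>p\<rfloor> + 1"
    have "0 < w" "0 \<le> p" using input(2) eps Mf assms(2) by (auto simp: w_def p_def)
    then have W: "w \<le> real W" "real W \<le> w + 1" "1 \<le> W" and q: "p < real q" "real q \<le> p + 1"
      unfolding W_def q_def by linarith+
    have "\<exists>j i. j \<le> q * W \<and> i < k (j + 1) \<and> objective f h (zh i) - opt_value (Rn n) f h \<le> ereal eps"
    proof (rule iteration_count)
      show "8 * (2 + C') * lam * Mf\<^sup>2 / (eps / 2) \<le> real W" using W(1) by (simp add: w_def field_simps)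
      show "(opt_dist (Rn n) f h x0)\<^sup>2 < 2 * lam * (eps - eps / 2) * real q"
        using q(1) input(2) eps by (simp add: p_def d0[symmetric] field_simps)
    qed (use eps W in auto)
    moreover have "real (q * W) \<le> (1 + C) * (16 * (2 + C') + C) * (1 + Mf\<^sup>2 * d0\<^sup>2 / eps\<^sup>2)"
    proof -
      have "real (q * W) \<le> (p + 1) * (w + 1)"
        unfolding of_nat_mult using W q \<open>0 < w\<close> \<open>0 \<le> p\<close> by (intro mult_mono) auto
      also have "\<dots> \<le> (1 + C) * (16 * (2 + C') + C) * (1 + Mf\<^sup>2 * d0\<^sup>2 / eps\<^sup>2)"
        unfolding p_def w_def using assms Mf eps lam by (intro stepsize_window_count_bound) auto
      finally show ?thesis .
    qed
    ultimately show "\<exists>j i. real j \<le> (1 + C) * (16 * (2 + C') + C) * (1 + Mf\<^sup>2 * d0\<^sup>2 / eps\<^sup>2)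
        \<and> i < k (j + 1) \<and> objective f h (zh i) - opt_value (Rn n) f h \<le> ereal eps"
      by (meson of_nat_le_iff order_trans)
  qed
qed

end
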